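(* Let $\mathbf{k}$ be a field, let $(A,\cdot_1,\circ)$ be a Jacobi Novikov-Poisson algebra over $\mathbf{k}$ and let $(B,\cdot_2,\diamond)$ be a right Jacobi Novikov-Poisson algebra over $\mathbf{k}$. Define two binary operations $\cdot$ and $[\cdot,\cdot]$ on $A\otimes B$ by $$(a_1\otimes a_2)\cdot(b_1\otimes b_2)=a_1\cdot_1 b_1\otimes a_2\cdot_2 b_2,$$ $$[a_1\otimes a_2,b_1\otimes b_2]=a_1\circ b_1\otimes a_2\diamond b_2-b_1\circ a_1\otimes b_2\diamond a_2$$ for all $a_1,b_1\in A$, $a_2,b_2\in B$. Then $(A\otimes B,\cdot,[\cdot,\cdot])$ is a Jacobi algebra with identity element $1_A\otimes 1_B$.
   Context: All vector spaces, algebras and tensor products are over $\mathbf{k}$; binary operations are bilinear. A Novikov algebra $(A,\circ)$ is a vector space with a binary operation satisfying $(a\circ b)\circ c-a\circ(b\circ c)=(b\circ a)\circ c-b\circ(a\circ c)$ and $(a\circ b)\circ c=(a\circ c)\circ b$ for all $a,b,c\in A$. A Jacobi Novikov-Poisson algebra is a triple $(A,\cdot,\circ)$ where $(A,\cdot)$ is a unital commutative associative algebra with identity $1_A$, $(A,\circ)$ is a Novikov algebra, and for all $a,b,c\in A$: $(a\cdot b)\circ c=a\cdot(b\circ c)$ and $c\circ(a\cdot b)=(c\circ a)\cdot b+a\cdot(c\circ b)-a\cdot b\cdot(c\circ 1_A)$. A right Jacobi Novikov-Poisson algebra is a triple $(B,\cdot,\diamond)$ such that $(B,\cdot,\circ)$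 with $a\circ b:=b\diamond a$ is a Jacobi Novikov-Poisson algebra. A Jacobi algebra is a triple $(J,\cdot,[\cdot,\cdot])$ where $(J,\cdot)$ is a unital commutative associative algebra with identity $1_J$, $(J,[\cdot,\cdot])$ is a Lie algebra, and $[a,b\cdot c]=[a,b]\cdot c+b\cdot[a,c]+b\cdot c\cdot[1_J,a]$ for all $a,b,c\in J$. *)

theory Defs
  imports "HOL-Algebra.Module" "HOL-Algebra.QuotRing"
begin

section \<open>Algebras with a bilinear operation\<close>

text \<open>
  A \<open>K\<close>-vector space is a module (in the sense of \<^locale>\<open>module\<close>) over a field \<open>K\<close>; its \<open>mult\<close> and
  \<open>one\<close> fields are then irrelevant.  A unital commutative associative \<open>K\<close>-algebra is an
  \<^locale>\<open>algebra\<close> over the field \<open>K\<close>.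
\<close>

definition module_bilinear ::
  "('k, 'm) ring_scheme \<Rightarrow> ('k, 'u, 'p) module_scheme \<Rightarrow> ('k, 'v, 'q) module_scheme \<Rightarrow>
   ('k, 'w, 'r) module_scheme \<Rightarrow> ('u \<Rightarrow> 'v \<Rightarrow> 'w) \<Rightarrow> bool"
  where "module_bilinear K U V W f \<longleftrightarrow>
    (\<forall>u\<in>carrier U. \<forall>v\<in>carrier V. f u v \<in> carrier W) \<and>
    (\<forall>u\<in>carrier U. \<forall>u'\<in>carrier U. \<forall>v\<in>carrier V. f (u \<oplus>\<^bsub>U\<^esub> u') v = f u v \<oplus>\<^bsub>W\<^esub> f u' v) \<and>
    (\<forall>u\<in>carrier U. \<forall>v\<in>carrier V. \<forall>v'\<in>carrier V. f u (v \<oplus>\<^bsub>V\<^esub> v') = f u v \<oplus>\<^bsub>W\<^esub> f u v') \<and>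
    (\<forall>c\<in>carrier K. \<forall>u\<in>carrier U. \<forall>v\<in>carrier V. f (c \<odot>\<^bsub>U\<^esub> u) v = c \<odot>\<^bsub>W\<^esub> f u v) \<and>
    (\<forall>c\<in>carrier K. \<forall>u\<in>carrier U. \<forall>v\<in>carrier V. f u (c \<odot>\<^bsub>V\<^esub> v) = c \<odot>\<^bsub>W\<^esub> f u v)"

locale novikov_algebra = field K + module K A
  for K (structure) and A (structure) +
  fixes nov :: "'c \<Rightarrow> 'c \<Rightarrow> 'c"
  assumes nov_bilinear: "module_bilinear K A A A nov"
    and left_symmetric: "\<lbrakk>a \<in> carrier A; b \<in> carrier A; c \<in> carrier A\<rbrakk> \<Longrightarrow>
      nov (nov a b) c \<ominus>\<^bsub>A\<^esub> nov a (nov b c) = nov (nov b a) c \<ominus>\<^bsub>A\<^esub> nov b (nov a c)"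
    and right_commutative: "\<lbrakk>a \<in> carrier A; b \<in> carrier A; c \<in> carrier A\<rbrakk> \<Longrightarrow>
      nov (nov a b) c = nov (nov a c) b"

locale jacobi_novikov_poisson_algebra = algebra K A + novikov_algebra K A nov
  for K (structure) and A (structure) and nov +
  assumes mult_nov: "\<lbrakk>a \<in> carrier A; b \<in> carrier A; c \<in> carrier A\<rbrakk> \<Longrightarrow>
      nov (a \<otimes>\<^bsub>A\<^esub> b) c = a \<otimes>\<^bsub>A\<^esub> nov b c"
    and nov_mult: "\<lbrakk>a \<in> carrier A; b \<in> carrier A; c \<in> carrier A\<rbrakk> \<Longrightarrow>
      nov c (a \<otimes>\<^bsub>A\<^esub> b) =
        (nov c a \<otimes>\<^bsub>A\<^esub> b \<oplus>\<^bsub>A\<^esub> a \<otimes>\<^bsub>A\<^esub> nov c b) \<ominus>\<^bsub>A\<^esub> (a \<otimes>\<^bsub>A\<^esub> b) \<otimes>\<^bsub>A\<^esub> nov c \<one>\<^bsub>A\<^esub>"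

definition right_jacobi_novikov_poisson_algebra ::
  "('k, 'm) ring_scheme \<Rightarrow> ('k, 'b, 'p) module_scheme \<Rightarrow> ('b \<Rightarrow> 'b \<Rightarrow> 'b) \<Rightarrow> bool"
  where "right_jacobi_novikov_poisson_algebra K B dia \<longleftrightarrow>
    jacobi_novikov_poisson_algebra K B (\<lambda>a b. dia b a)"

locale lie_algebra = field K + module K L
  for K (structure) and L (structure) +
  fixes br :: "'c \<Rightarrow> 'c \<Rightarrow> 'c"
  assumes br_bilinear: "module_bilinear K L L L br"
    and br_alternating: "a \<in> carrier L \<Longrightarrow> br a a = \<zero>\<^bsub>L\<^esub>"
    and br_jacobi: "\<lbrakk>a \<in> carrier L; b \<in> carrier L; c \<in> carrier L\<rbrakk> \<Longrightarrow>
      br a (br b c) \<oplus>\<^bsub>L\<^esub> br b (br c a) \<oplus>\<^bsub>L\<^esub> br c (br a b) = \<zero>\<^bsub>L\<^esub>"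

locale jacobi_algebra = algebra K J + lie_algebra K J br
  for K (structure) and J (structure) and br +
  assumes br_mult: "\<lbrakk>a \<in> carrier J; b \<in> carrier J; c \<in> carrier J\<rbrakk> \<Longrightarrow>
      br a (b \<otimes>\<^bsub>J\<^esub> c) =
        (br a b \<otimes>\<^bsub>J\<^esub> c \<oplus>\<^bsub>J\<^esub> b \<otimes>\<^bsub>J\<^esub> br a c) \<oplus>\<^bsub>J\<^esub> (b \<otimes>\<^bsub>J\<^esub> c) \<otimes>\<^bsub>J\<^esub> br \<one>\<^bsub>J\<^esub> a"


section \<open>Tensor product of modules\<close>

text \<open>
  The tensor product is constructed as the free module on the set of pairs, modulo the submodule
  generated by the bilinearity relations.  The \<open>mult\<close> and \<open>one\<close> fields of the modules below carry no
  information.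
\<close>

definition free_module :: "('k, 'm) ring_scheme \<Rightarrow> 'x set \<Rightarrow> ('k, 'x \<Rightarrow> 'k) module"
  where "free_module K S =
    \<lparr>carrier = {f. (\<forall>x. f x \<in> carrier K) \<and> {x. f x \<noteq> \<zero>\<^bsub>K\<^esub>} \<subseteq> S \<and> finite {x. f x \<noteq> \<zero>\<^bsub>K\<^esub>}},
     monoid.mult = undefined, one = undefined,
     zero = (\<lambda>x. \<zero>\<^bsub>K\<^esub>), add = (\<lambda>f g x. f x \<oplus>\<^bsub>K\<^esub> g x),
     smult = (\<lambda>c f x. c \<otimes>\<^bsub>K\<^esub> f x)\<rparr>"

definition free_gen :: "('k, 'm) ring_scheme \<Rightarrow> 'x \<Rightarrow> 'x \<Rightarrow> 'k"
  where "free_gen K x = (\<lambda>y. if y = x then \<one>\<^bsub>K\<^esub> else \<zero>\<^bsub>K\<^esub>)"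

definition submodule_generated ::
  "('k, 'm) ring_scheme \<Rightarrow> ('k, 'v, 'p) module_scheme \<Rightarrow> 'v set \<Rightarrow> 'v set"
  where "submodule_generated K M S = \<Inter>{H. submodule H K M \<and> S \<subseteq> H}"

text \<open>As with \<^const>\<open>FactRing\<close>, the elements of the quotient are the cosets of \<open>N\<close>.\<close>

definition quotient_module :: "('k, 'v, 'p) module_scheme \<Rightarrow> 'v set \<Rightarrow> ('k, 'v set) module"
  where "quotient_module M N =
    \<lparr>carrier = a_rcosets\<^bsub>M\<^esub> N, monoid.mult = undefined, one = undefined,
     zero = N, add = set_add M,
     smult = (\<lambda>c X. \<Union>x\<in>X. N +>\<^bsub>M\<^esub> (c \<odot>\<^bsub>M\<^esub> x))\<rparr>"

definition tensor_relations ::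
  "('k, 'm) ring_scheme \<Rightarrow> ('k, 'a, 'p) module_scheme \<Rightarrow> ('k, 'b, 'q) module_scheme \<Rightarrow>
   ('a \<times> 'b \<Rightarrow> 'k) set"
  where "tensor_relations K A B =
    (let F = free_module K (carrier A \<times> carrier B); e = free_gen K in
      {e (a \<oplus>\<^bsub>A\<^esub> a', b) \<ominus>\<^bsub>F\<^esub> (e (a, b) \<oplus>\<^bsub>F\<^esub> e (a', b)) | a a' b.
         a \<in> carrier A \<and> a' \<in> carrier A \<and> b \<in> carrier B} \<union>
      {e (a, b \<oplus>\<^bsub>B\<^esub> b') \<ominus>\<^bsub>F\<^esub> (e (a, b) \<oplus>\<^bsub>F\<^esub> e (a, b')) | a b b'.
         a \<in> carrier A \<and> b \<in> carrier B \<and> b' \<in> carrier B} \<union>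
      {e (c \<odot>\<^bsub>A\<^esub> a, b) \<ominus>\<^bsub>F\<^esub> c \<odot>\<^bsub>F\<^esub> e (a, b) | c a b.
         c \<in> carrier K \<and> a \<in> carrier A \<and> b \<in> carrier B} \<union>
      {e (a, c \<odot>\<^bsub>B\<^esub> b) \<ominus>\<^bsub>F\<^esub> c \<odot>\<^bsub>F\<^esub> e (a, b) | c a b.
         c \<in> carrier K \<and> a \<in> carrier A \<and> b \<in> carrier B})"

definition tensor_kernel ::
  "('k, 'm) ring_scheme \<Rightarrow> ('k, 'a, 'p) module_scheme \<Rightarrow> ('k, 'b, 'q) module_scheme \<Rightarrow>
   ('a \<times> 'b \<Rightarrow> 'k) set"
  where "tensor_kernel K A B =
    submodule_generated K (free_module K (carrier A \<times> carrier B)) (tensor_relations K A B)"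

definition tensor_product ::
  "('k, 'm) ring_scheme \<Rightarrow> ('k, 'a, 'p) module_scheme \<Rightarrow> ('k, 'b, 'q) module_scheme \<Rightarrow>
   ('k, ('a \<times> 'b \<Rightarrow> 'k) set) module"
  where "tensor_product K A B =
    quotient_module (free_module K (carrier A \<times> carrier B)) (tensor_kernel K A B)"

definition pure_tensor ::
  "('k, 'm) ring_scheme \<Rightarrow> ('k, 'a, 'p) module_scheme \<Rightarrow> ('k, 'b, 'q) module_scheme \<Rightarrow>
   'a \<Rightarrow> 'b \<Rightarrow> ('a \<times> 'b \<Rightarrow> 'k) set"
  where "pure_tensor K A B a b =
    tensor_kernel K A B +>\<^bsub>free_module K (carrier A \<times> carrier B)\<^esub> free_gen K (a, b)"


section \<open>The two operations on the tensor product\<close>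

text \<open>
  An operation given on pure tensors is understood to be the bilinear one with these values.
\<close>

definition is_tensor_mult ::
  "('k, 'm) ring_scheme \<Rightarrow> ('k, 'a, 'p) module_scheme \<Rightarrow> ('k, 'b, 'q) module_scheme \<Rightarrow>
   (('a \<times> 'b \<Rightarrow> 'k) set \<Rightarrow> ('a \<times> 'b \<Rightarrow> 'k) set \<Rightarrow> ('a \<times> 'b \<Rightarrow> 'k) set) \<Rightarrow> bool"
  where "is_tensor_mult K A B mul \<longleftrightarrow>
    (let T = tensor_product K A B; t = pure_tensor K A B in
      module_bilinear K T T T mul \<and>
      (\<forall>a1\<in>carrier A. \<forall>b1\<in>carrier A. \<forall>a2\<in>carrier B. \<forall>b2\<in>carrier B.
         mul (t a1 a2) (t b1 b2) = t (a1 \<otimes>\<^bsub>A\<^esub> b1) (a2 \<otimes>\<^bsub>B\<^esub> b2)))"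

definition is_tensor_bracket ::
  "('k, 'm) ring_scheme \<Rightarrow> ('k, 'a, 'p) module_scheme \<Rightarrow> ('k, 'b, 'q) module_scheme \<Rightarrow>
   ('a \<Rightarrow> 'a \<Rightarrow> 'a) \<Rightarrow> ('b \<Rightarrow> 'b \<Rightarrow> 'b) \<Rightarrow>
   (('a \<times> 'b \<Rightarrow> 'k) set \<Rightarrow> ('a \<times> 'b \<Rightarrow> 'k) set \<Rightarrow> ('a \<times> 'b \<Rightarrow> 'k) set) \<Rightarrow> bool"
  where "is_tensor_bracket K A B circ dia br \<longleftrightarrow>
    (let T = tensor_product K A B; t = pure_tensor K A B in
      module_bilinear K T T T br \<and>
      (\<forall>a1\<in>carrier A. \<forall>b1\<in>carrier A. \<forall>a2\<in>carrier B. \<forall>b2\<in>carrier B.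
         br (t a1 a2) (t b1 b2) =
           t (circ a1 b1) (dia a2 b2) \<ominus>\<^bsub>T\<^esub> t (circ b1 a1) (dia b2 a2)))"

end

theory Submission
  imports Defs
begin

text \<open>
  The tensor product \<open>T\<close> is a quotient of a free module, so an operation on it cannot be given by a
  formula in elements.  Two consequences of the construction replace such formulas.  By
  \<open>tensor_lift\<close>, a bilinear map on \<open>A \<times> B\<close> extends to a linear map on \<open>T\<close>; applied once per argument,
  this turns a map that is linear in each of four arguments into a bilinear one on \<open>T\<close>
  (\<open>tensor_bilinear_lift\<close>).  By \<open>tensor_induct\<close>, the elements of \<open>T\<close> are sums of pure tensors, so
  bilinear operations are determined by their values on pure tensors, and a multilinear identity
  holds on \<open>T\<close> as soon as it holds there.  The first fact gives existence of the product and the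
  bracket, the second their uniqueness, and what remains are computations with pure tensors.  Below,
  \<open>a1 \<otimes> a2\<close>, \<open>b1 \<otimes> b2\<close>, \<open>c1 \<otimes> c2\<close> are pure tensors, and \<open>B\<close> is used
  through the opposite operation \<open>x \<circ>' y = y \<diamond> x\<close>.

  Jacobi identity.  Here juxtaposition stands for \<open>\<circ>\<close>.  Right commutativity leaves three of the six products \<open>(xy)z\<close> of three given
  elements, say \<open>p\<^sub>x = (xy)z\<close>, and left symmetry makes \<open>q\<^sub>z = x(yz) - (xy)z\<close> symmetric in \<open>x\<close> and
  \<open>y\<close>.  Hence all twelve products are \<open>p\<^sub>x\<close> or \<open>p\<^sub>x + q\<^sub>z\<close> (\<open>triple_products\<close>).  With \<open>P\<close>, \<open>Q\<close> the
  corresponding elements for \<open>\<circ>'\<close> one finds that \<open>[a,[b,c]]\<close> equals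
  \<open>(p\<^sub>a + q\<^sub>c) \<otimes> P\<^sub>c - p\<^sub>b \<otimes> (P\<^sub>a + Q\<^sub>b) - (p\<^sub>a + q\<^sub>b) \<otimes> P\<^sub>b + p\<^sub>c \<otimes> (P\<^sub>a + Q\<^sub>c)\<close>,
  and the cyclic sum of this expression is zero.

  Leibniz rule.  Here juxtaposition stands for the commutative multiplications.  Since \<open>\<circ>\<close> is linear over multiplication in its left argument, the products
  \<open>(b1 \<circ> a1)c1\<close>, \<open>b1(c1 \<circ> a1)\<close> and \<open>b1 c1 (1 \<circ> a1)\<close> all equal \<open>Y = (b1 c1) \<circ> a1\<close>; similarly in \<open>B\<close>
  the products \<open>(a2 \<diamond> b2)c2\<close>, \<open>b2(a2 \<diamond> c2)\<close> and \<open>b2 c2 (a2 \<diamond> 1)\<close> equal \<open>U = a2 \<diamond> (b2 c2)\<close>.  The twisted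
  derivation rule gives \<open>a1 \<circ> (b1 c1) = X\<^sub>1 + X\<^sub>2 - X\<^sub>3\<close> with \<open>X\<^sub>1 = (a1 \<circ> b1)c1\<close>,
  \<open>X\<^sub>2 = b1(a1 \<circ> c1)\<close>, \<open>X\<^sub>3 = b1 c1 (a1 \<circ> 1)\<close>, and \<open>(b2 c2) \<diamond> a2 = V\<^sub>1 + V\<^sub>2 - V\<^sub>3\<close> with
  \<open>V\<^sub>1 = (b2 \<diamond> a2)c2\<close>, \<open>V\<^sub>2 = b2(c2 \<diamond> a2)\<close>, \<open>V\<^sub>3 = b2 c2 (1 \<diamond> a2)\<close>, so
  \<open>[a, bc] = (X\<^sub>1 + X\<^sub>2 - X\<^sub>3) \<otimes> U - Y \<otimes> (V\<^sub>1 + V\<^sub>2 - V\<^sub>3)\<close>.  The three differences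
  \<open>X\<^sub>1 \<otimes> U - Y \<otimes> V\<^sub>1\<close>, \<open>X\<^sub>2 \<otimes> U - Y \<otimes> V\<^sub>2\<close> and \<open>Y \<otimes> V\<^sub>3 - X\<^sub>3 \<otimes> U\<close> are \<open>[a,b]c\<close>, \<open>b[a,c]\<close> and
  \<open>bc[1,a]\<close>.
\<close>

section \<open>Linear and bilinear maps\<close>

definition module_linear ::
  "('k, 'm) ring_scheme \<Rightarrow> ('k, 'v, 'q) module_scheme \<Rightarrow> ('k, 'w, 'r) module_scheme \<Rightarrow>
   ('v \<Rightarrow> 'w) \<Rightarrow> bool"
  where "module_linear K V W h \<longleftrightarrow>
    (\<forall>v\<in>carrier V. h v \<in> carrier W) \<and>
    (\<forall>v\<in>carrier V. \<forall>v'\<in>carrier V. h (v \<oplus>\<^bsub>V\<^esub> v') = h v \<oplus>\<^bsub>W\<^esub> h v') \<and>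
    (\<forall>c\<in>carrier K. \<forall>v\<in>carrier V. h (c \<odot>\<^bsub>V\<^esub> v) = c \<odot>\<^bsub>W\<^esub> h v)"

lemma module_linearI:
  assumes "\<And>v. v \<in> carrier V \<Longrightarrow> h v \<in> carrier W"
    and "\<And>v v'. \<lbrakk>v \<in> carrier V; v' \<in> carrier V\<rbrakk> \<Longrightarrow> h (v \<oplus>\<^bsub>V\<^esub> v') = h v \<oplus>\<^bsub>W\<^esub> h v'"
    and "\<And>c v. \<lbrakk>c \<in> carrier K; v \<in> carrier V\<rbrakk> \<Longrightarrow> h (c \<odot>\<^bsub>V\<^esub> v) = c \<odot>\<^bsub>W\<^esub> h v"
  shows "module_linear K V W h"
  using assms by (simp add: module_linear_def)

lemma module_linearD:
  assumes "module_linear K V W h"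
  shows "v \<in> carrier V \<Longrightarrow> h v \<in> carrier W"
    and "\<lbrakk>v \<in> carrier V; v' \<in> carrier V\<rbrakk> \<Longrightarrow> h (v \<oplus>\<^bsub>V\<^esub> v') = h v \<oplus>\<^bsub>W\<^esub> h v'"
    and "\<lbrakk>c \<in> carrier K; v \<in> carrier V\<rbrakk> \<Longrightarrow> h (c \<odot>\<^bsub>V\<^esub> v) = c \<odot>\<^bsub>W\<^esub> h v"
  using assms by (simp_all add: module_linear_def)

lemma module_linear_zero:
  assumes "module K V" "module K W" "module_linear K V W h"
  shows "h \<zero>\<^bsub>V\<^esub> = \<zero>\<^bsub>W\<^esub>"
proof -
  interpret V: module K V by fact
  interpret W: module K W by fact
  have "h \<zero>\<^bsub>V\<^esub> \<oplus>\<^bsub>W\<^esub> h \<zero>\<^bsub>V\<^esub> = h \<zero>\<^bsub>V\<^esub>"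
    using module_linearD(2)[OF assms(3), of "\<zero>\<^bsub>V\<^esub>" "\<zero>\<^bsub>V\<^esub>"] by simp
  then show ?thesis
    using module_linearD(1)[OF assms(3), of "\<zero>\<^bsub>V\<^esub>"] by (simp add: W.M.add.l_cancel_one)
qed

lemma module_linear_minus:
  assumes "module K V" "module K W" "module_linear K V W h" "x \<in> carrier V"
  shows "h (\<ominus>\<^bsub>V\<^esub> x) = \<ominus>\<^bsub>W\<^esub> h x"
proof -
  interpret V: module K V by fact
  interpret W: module K W by fact
  have "h (\<ominus>\<^bsub>V\<^esub> x) \<oplus>\<^bsub>W\<^esub> h x = h (\<ominus>\<^bsub>V\<^esub> x \<oplus>\<^bsub>V\<^esub> x)"
    using module_linearD(2)[OF assms(3)] assms(4) by simp
  also have "\<dots> = \<zero>\<^bsub>W\<^esub>"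
    using assms(4) by (simp add: V.M.l_neg module_linear_zero[OF assms(1-3)])
  finally show ?thesis
    using module_linearD(1)[OF assms(3)] assms(4) by (simp add: W.M.minus_equality)
qed

lemma module_linear_diff:
  assumes "module K V" "module K W" "module_linear K V W h" "x \<in> carrier V" "y \<in> carrier V"
  shows "h (x \<ominus>\<^bsub>V\<^esub> y) = h x \<ominus>\<^bsub>W\<^esub> h y"
proof -
  interpret V: module K V by fact
  interpret W: module K W by fact
  show ?thesis
    using assms(4,5) module_linearD(2)[OF assms(3)] 
    by (simp add: a_minus_def module_linear_minus[OF assms(1-3)])
qed

lemma module_bilinearI:
  assumes "\<And>v. v \<in> carrier V \<Longrightarrow> module_linear K U W (\<lambda>u. f u v)"
    and "\<And>u. u \<in> carrier U \<Longrightarrow> module_linear K V W (f u)"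
  shows "module_bilinear K U V W f"
  using assms by (simp add: module_linear_def module_bilinear_def)

lemma module_bilinearD:
  assumes "module_bilinear K U V W f"
  shows "v \<in> carrier V \<Longrightarrow> module_linear K U W (\<lambda>u. f u v)"
    and "u \<in> carrier U \<Longrightarrow> module_linear K V W (f u)"
    and "\<lbrakk>u \<in> carrier U; v \<in> carrier V\<rbrakk> \<Longrightarrow> f u v \<in> carrier W"
  using assms by (simp_all add: module_linear_def module_bilinear_def)


section \<open>Quotient modules\<close>

context
  fixes K :: "('k, 'm) ring_scheme" and M :: "('k, 'v, 'p) module_scheme" and N
  assumes module_M: "module K M" and submodule_N: "submodule N K M"
begin

interpretation M: module K M by (rule module_M)
interpretation N: submodule N K M by (rule submodule_N)
interpretation N: abelian_subgroup N M
  by (intro abelian_subgroupI3 additive_subgroup.intro N.subgroup_axioms M.abelian_group_axioms)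

lemma quotient_carrier: "carrier (quotient_module M N) = (\<lambda>x. N +>\<^bsub>M\<^esub> x) ` carrier M"
  by (auto simp: quotient_module_def A_RCOSETS_def' )

lemma quotient_zero: "\<zero>\<^bsub>quotient_module M N\<^esub> = N +>\<^bsub>M\<^esub> \<zero>\<^bsub>M\<^esub>"
  using N.a_rcos_const[of "\<zero>\<^bsub>M\<^esub>"] by (simp add: quotient_module_def)

lemma quotient_add:
  "\<lbrakk>x \<in> carrier M; y \<in> carrier M\<rbrakk> \<Longrightarrow>
    (N +>\<^bsub>M\<^esub> x) \<oplus>\<^bsub>quotient_module M N\<^esub> (N +>\<^bsub>M\<^esub> y) = N +>\<^bsub>M\<^esub> (x \<oplus>\<^bsub>M\<^esub> y)"
  by (simp add: quotient_module_def N.a_rcos_sum)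

lemma quotient_eq_iff:
  assumes "x \<in> carrier M" "y \<in> carrier M"
  shows "N +>\<^bsub>M\<^esub> x = N +>\<^bsub>M\<^esub> y \<longleftrightarrow> x \<ominus>\<^bsub>M\<^esub> y \<in> N"
  using assms N.a_rcos_module[of y x] N.a_repr_independence'[of x y] N.a_rcos_self[of x]
  by (auto simp: a_minus_def)

text \<open>
  The scalar multiple of a coset is a union over all its elements; the sets in this union coincide
  because \<open>c \<odot> (y - x)\<close> lies in the submodule \<open>N\<close> whenever \<open>y - x\<close> does.
\<close>

lemma quotient_smult:
  assumes c: "c \<in> carrier K" and x: "x \<in> carrier M"
  shows "c \<odot>\<^bsub>quotient_module M N\<^esub> (N +>\<^bsub>M\<^esub> x) = N +>\<^bsub>M\<^esub> (c \<odot>\<^bsub>M\<^esub> x)"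
proof -
  have "N +>\<^bsub>M\<^esub> (c \<odot>\<^bsub>M\<^esub> y) = N +>\<^bsub>M\<^esub> (c \<odot>\<^bsub>M\<^esub> x)" if "y \<in> N +>\<^bsub>M\<^esub> x" for y
  proof -
    have y: "y \<in> carrier M"
      using that x N.a_elemrcos_carrier by blast
    have "y \<ominus>\<^bsub>M\<^esub> x \<in> N"
      using that x y by (metis N.a_repr_independence' quotient_eq_iff)
    then have "c \<odot>\<^bsub>M\<^esub> (y \<ominus>\<^bsub>M\<^esub> x) \<in> N"
      using c by simp
    then have "c \<odot>\<^bsub>M\<^esub> y \<ominus>\<^bsub>M\<^esub> c \<odot>\<^bsub>M\<^esub> x \<in> N"
      using c x y by (simp add: a_minus_def M.smult_r_distr M.smult_r_minus)
    then show ?thesis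
      using c x y by (simp add: quotient_eq_iff)
  qed
  then have "(\<Union>y\<in>N +>\<^bsub>M\<^esub> x. N +>\<^bsub>M\<^esub> (c \<odot>\<^bsub>M\<^esub> y)) = N +>\<^bsub>M\<^esub> (c \<odot>\<^bsub>M\<^esub> x)"
    using N.a_rcos_self[OF x] by blast
  then show ?thesis
    by (simp add: quotient_module_def)
qed

lemma quotient_module_module: "module K (quotient_module M N)"
proof (rule moduleI)
  show "cring K" by unfold_locales
  show "abelian_group (quotient_module M N)"
  proof (rule abelian_groupI)
    fix X assume "X \<in> carrier (quotient_module M N)"
    then obtain x where x: "x \<in> carrier M" "X = N +>\<^bsub>M\<^esub> x" by (auto simp: quotient_carrier)
    show "\<exists>Y\<in>carrier (quotient_module M N). Y \<oplus>\<^bsub>quotient_module M N\<^esub> X = \<zero>\<^bsub>quotient_module M N\<^esub>"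
      by (rule bexI[of _ "N +>\<^bsub>M\<^esub> (\<ominus>\<^bsub>M\<^esub> x)"])
        (use x in \<open>auto simp: quotient_carrier quotient_add quotient_zero M.M.l_neg\<close>)
  qed (auto simp: quotient_carrier quotient_add quotient_zero M.M.a_ac)
qed (auto simp: quotient_carrier quotient_add quotient_smult M.smult_l_distr M.smult_r_distr
      M.smult_assoc1)

lemma coset_linear: "module_linear K M (quotient_module M N) (\<lambda>x. N +>\<^bsub>M\<^esub> x)"
  by (rule module_linearI) (auto simp: quotient_carrier quotient_add quotient_smult)

text \<open>
  The value on a coset is the value of \<open>h\<close> at a chosen representative; two representatives differ by
  an element of \<open>N\<close>, on which \<open>h\<close> vanishes.
\<close>

lemma quotient_lift:
  assumes W: "module K W" and h: "module_linear K M W h"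
    and vanish: "\<And>x. x \<in> N \<Longrightarrow> h x = \<zero>\<^bsub>W\<^esub>"
  shows "\<exists>g. module_linear K (quotient_module M N) W g \<and> (\<forall>x\<in>carrier M. g (N +>\<^bsub>M\<^esub> x) = h x)"
proof -
  interpret W: module K W by fact
  define g where "g X = h (SOME x. x \<in> carrier M \<and> X = N +>\<^bsub>M\<^esub> x)" for X
  have g: "g (N +>\<^bsub>M\<^esub> x) = h x" if x: "x \<in> carrier M" for x
  proof -
    define y where "y = (SOME y. y \<in> carrier M \<and> N +>\<^bsub>M\<^esub> x = N +>\<^bsub>M\<^esub> y)"
    have y: "y \<in> carrier M" "N +>\<^bsub>M\<^esub> x = N +>\<^bsub>M\<^esub> y"
      using someI[of "\<lambda>y. y \<in> carrier M \<and> N +>\<^bsub>M\<^esub> x = N +>\<^bsub>M\<^esub> y" x] x by (auto simp: y_def)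
    then have "h (x \<ominus>\<^bsub>M\<^esub> y) = \<zero>\<^bsub>W\<^esub>"
      using x vanish quotient_eq_iff by blast
    then have "h x \<oplus>\<^bsub>W\<^esub> \<ominus>\<^bsub>W\<^esub> h y = \<zero>\<^bsub>W\<^esub>"
      using x y module_linear_diff[OF module_M W h] by (simp add: a_minus_def)
    then have "h x = h y"
      using x y module_linearD(1)[OF h] W.M.minus_equality[of "h x" "\<ominus>\<^bsub>W\<^esub> h y"] by simp
    then show ?thesis by (simp add: g_def y_def)
  qed
  have "module_linear K (quotient_module M N) W g"
    by (rule module_linearI)
      (auto simp: quotient_carrier quotient_add quotient_smult g module_linearD[OF h])
  with g show ?thesis by blast
qed

end

lemma submodule_generated_submodule:
  assumes "module K M" "S \<subseteq> carrier M"
  shows "submodule (submodule_generated K M S) K M"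
proof -
  interpret M: module K M by fact
  show ?thesis
    unfolding submodule_generated_def
    using assms M.carrier_is_submodule M.submoduleE
    by (intro M.submoduleI)
       (auto simp: subset_iff submodule_def dest: subgroup.one_closed)
qed

lemma submodule_generated_superset: "S \<subseteq> submodule_generated K M S"
  by (auto simp: submodule_generated_def)

lemma linear_kernel_submodule:
  assumes "module K V" "module K W" "module_linear K V W h"
  shows "submodule {x \<in> carrier V. h x = \<zero>\<^bsub>W\<^esub>} K V"
proof -
  interpret V: module K V by fact
  interpret W: module K W by fact
  show ?thesis
    by (rule V.submoduleI)
      (auto simp: module_linearD[OF assms(3)] module_linear_zero[OF assms] module_linear_minus[OF assms])
qed


section \<open>Free modules\<close>

context
  fixes K :: "('k, 'm) ring_scheme" and S :: "'x set"
  assumes cring_K: "cring K"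
begin

interpretation K: cring K by (rule cring_K)

lemma free_module_module: "module K (free_module K S)"
proof (rule moduleI)
  show "cring K" by (rule cring_K)
  have fin: "finite {x. f x \<oplus>\<^bsub>K\<^esub> g x \<noteq> \<zero>\<^bsub>K\<^esub>}"
    if "finite {x. f x \<noteq> \<zero>\<^bsub>K\<^esub>}" "finite {x. g x \<noteq> \<zero>\<^bsub>K\<^esub>}" for f g :: "'x \<Rightarrow> 'k"
    by (rule finite_subset[OF _ finite_UnI[OF that]]) auto
  have fins: "finite {x. c \<otimes>\<^bsub>K\<^esub> g x \<noteq> \<zero>\<^bsub>K\<^esub>}"
    if "finite {x. g x \<noteq> \<zero>\<^bsub>K\<^esub>}" "c \<in> carrier K" for c and g :: "'x \<Rightarrow> 'k"
    by (rule finite_subset[OF _ that(1)]) (use that in auto)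
  have finm: "{x. \<ominus>\<^bsub>K\<^esub> f x \<noteq> \<zero>\<^bsub>K\<^esub>} \<subseteq> {x. f x \<noteq> \<zero>\<^bsub>K\<^esub>}" for f :: "'x \<Rightarrow> 'k"
    by auto
  show "abelian_group (free_module K S)"
  proof (rule abelian_groupI)
    fix f assume "f \<in> carrier (free_module K S)"
    then show "\<exists>g\<in>carrier (free_module K S). g \<oplus>\<^bsub>free_module K S\<^esub> f = \<zero>\<^bsub>free_module K S\<^esub>"
      by (intro bexI[of _ "\<lambda>x. \<ominus>\<^bsub>K\<^esub> f x"])
        (use finm[of f] in \<open>auto simp: free_module_def K.l_neg intro: finite_subset\<close>)
  qed (auto simp: free_module_def fin K.a_ac subset_iff, metis K.l_zero K.zero_closed)
  show "c \<odot>\<^bsub>free_module K S\<^esub> f \<in> carrier (free_module K S)"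
    if "c \<in> carrier K" "f \<in> carrier (free_module K S)" for c f
    using that by (auto simp: free_module_def fins)
qed (auto simp: free_module_def K.l_distr K.r_distr K.m_assoc)

lemma free_gen_closed: "x \<in> S \<Longrightarrow> free_gen K x \<in> carrier (free_module K S)"
  by (auto simp: free_module_def free_gen_def)

text \<open>
  The extension sends \<open>f\<close> to \<open>\<Sum>x. f x \<odot> w x\<close>, summed over the support of \<open>f\<close>.  For additivity the sums
  are taken over the union of two supports, which changes nothing since the new terms vanish.
\<close>

lemma free_module_lift:
  assumes W: "module K W" and w: "\<And>x. x \<in> S \<Longrightarrow> w x \<in> carrier W"
  shows "\<exists>h. module_linear K (free_module K S) W h \<and> (\<forall>x\<in>S. h (free_gen K x) = w x)"
proof -
  interpret W: module K W by fact
  define h where "h f = (\<Oplus>\<^bsub>W\<^esub>x\<in>{x. f x \<noteq> \<zero>\<^bsub>K\<^esub>}. f x \<odot>\<^bsub>W\<^esub> w x)" for f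
  have h_on: "h f = (\<Oplus>\<^bsub>W\<^esub>x\<in>D. f x \<odot>\<^bsub>W\<^esub> w x)"
    if "finite D" "{x. f x \<noteq> \<zero>\<^bsub>K\<^esub>} \<subseteq> D" "D \<subseteq> S" "\<And>x. f x \<in> carrier K" for f D
    unfolding h_def
    by (rule W.M.add.finprod_mono_neutral_cong_left) (use that w in auto)
  have linear: "module_linear K (free_module K S) W h"
  proof (rule module_linearI)
    fix f assume f: "f \<in> carrier (free_module K S)"
    then show "h f \<in> carrier W"
      unfolding h_def by (intro W.M.finsum_closed) (auto simp: free_module_def w subset_iff)
    {
      fix g assume g: "g \<in> carrier (free_module K S)"
      let ?D = "{x. f x \<noteq> \<zero>\<^bsub>K\<^esub>} \<union> {x. g x \<noteq> \<zero>\<^bsub>K\<^esub>}"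
      have D: "finite ?D" "?D \<subseteq> S" using f g by (auto simp: free_module_def)
      have c: "f x \<in> carrier K" "g x \<in> carrier K" for x using f g by (auto simp: free_module_def)
      have "h (f \<oplus>\<^bsub>free_module K S\<^esub> g) = (\<Oplus>\<^bsub>W\<^esub>x\<in>?D. (f x \<oplus>\<^bsub>K\<^esub> g x) \<odot>\<^bsub>W\<^esub> w x)"
        by (subst h_on[OF D(1) _ D(2)]) (use c in \<open>auto simp: free_module_def\<close>)
      also have "\<dots> = (\<Oplus>\<^bsub>W\<^esub>x\<in>?D. f x \<odot>\<^bsub>W\<^esub> w x \<oplus>\<^bsub>W\<^esub> g x \<odot>\<^bsub>W\<^esub> w x)"
        by (rule W.M.finsum_cong') (use c D w in \<open>auto simp: W.smult_l_distr subset_iff\<close>)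
      also have "\<dots> = (\<Oplus>\<^bsub>W\<^esub>x\<in>?D. f x \<odot>\<^bsub>W\<^esub> w x) \<oplus>\<^bsub>W\<^esub> (\<Oplus>\<^bsub>W\<^esub>x\<in>?D. g x \<odot>\<^bsub>W\<^esub> w x)"
        by (rule W.M.finsum_addf) (use c D w in \<open>auto simp: subset_iff\<close>)
      also have "\<dots> = h f \<oplus>\<^bsub>W\<^esub> h g"
        using h_on[OF D(1) _ D(2), of f] h_on[OF D(1) _ D(2), of g] c by auto
      finally show "h (f \<oplus>\<^bsub>free_module K S\<^esub> g) = h f \<oplus>\<^bsub>W\<^esub> h g" .
    }
    fix c assume c: "c \<in> carrier K"
    let ?D = "{x. f x \<noteq> \<zero>\<^bsub>K\<^esub>}"
    have D: "finite ?D" "?D \<subseteq> S" and f': "\<And>x. f x \<in> carrier K"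
      using f by (auto simp: free_module_def)
    have "h (c \<odot>\<^bsub>free_module K S\<^esub> f) = (\<Oplus>\<^bsub>W\<^esub>x\<in>?D. (c \<otimes>\<^bsub>K\<^esub> f x) \<odot>\<^bsub>W\<^esub> w x)"
      by (subst h_on[OF D(1) _ D(2)]) (use c f' in \<open>auto simp: free_module_def\<close>)
    also have "\<dots> = (\<Oplus>\<^bsub>W\<^esub>x\<in>?D. c \<odot>\<^bsub>W\<^esub> (f x \<odot>\<^bsub>W\<^esub> w x))"
      by (rule W.M.finsum_cong') (use c f' D w in \<open>auto simp: W.smult_assoc1 subset_iff\<close>)
    also have "\<dots> = c \<odot>\<^bsub>W\<^esub> h f"
      unfolding h_def
      by (rule W.finsum_smult_ldistr[symmetric]) (use c f' D w in \<open>auto simp: subset_iff\<close>)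
    finally show "h (c \<odot>\<^bsub>free_module K S\<^esub> f) = c \<odot>\<^bsub>W\<^esub> h f" .
  qed
  have "h (free_gen K x) = w x" if "x \<in> S" for x
  proof -
    have "h (free_gen K x) = (\<Oplus>\<^bsub>W\<^esub>y\<in>{x}. free_gen K x y \<odot>\<^bsub>W\<^esub> w y)"
      by (rule h_on) (use that in \<open>auto simp: free_gen_def\<close>)
    also have "\<dots> = w x" using w[OF that] by (simp add: free_gen_def)
    finally show ?thesis .
  qed
  with linear show ?thesis by blast
qed

end

text \<open>
  A finitely supported function is built from zero by adding one multiple of a generator for each
  point of its support.
\<close>

lemma free_module_induct [consumes 2, case_names zero gen]:
  assumes "cring K" and "f \<in> carrier (free_module K S)"
    and zero: "P \<zero>\<^bsub>free_module K S\<^esub>"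
    and gen: "\<And>c x f. \<lbrakk>c \<in> carrier K; x \<in> S; f \<in> carrier (free_module K S); P f\<rbrakk> \<Longrightarrow>
      P (c \<odot>\<^bsub>free_module K S\<^esub> free_gen K x \<oplus>\<^bsub>free_module K S\<^esub> f)"
  shows "P f"
proof -
  interpret K: cring K by fact
  have "finite D \<Longrightarrow> f \<in> carrier (free_module K S) \<Longrightarrow> {x. f x \<noteq> \<zero>\<^bsub>K\<^esub>} = D \<Longrightarrow> P f" for D
  proof (induction D arbitrary: f rule: finite_induct)
    case empty
    then have "f = \<zero>\<^bsub>free_module K S\<^esub>" by (auto simp: free_module_def)
    then show ?case using zero by simp
  next
    case (insert x D)
    let ?g = "f(x := \<zero>\<^bsub>K\<^esub>)"
    have supp: "{y. ?g y \<noteq> \<zero>\<^bsub>K\<^esub>} = D" using insert by auto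
    have f: "f y \<in> carrier K" for y using insert.prems by (auto simp: free_module_def)
    have x: "x \<in> S" using insert.prems by (auto simp: free_module_def)
    have g: "?g \<in> carrier (free_module K S)"
      using insert.prems insert.hyps(1) supp by (auto simp: free_module_def)
    have "f = f x \<odot>\<^bsub>free_module K S\<^esub> free_gen K x \<oplus>\<^bsub>free_module K S\<^esub> ?g"
      using f by (auto simp: free_module_def free_gen_def fun_eq_iff)
    then show ?case
      using gen[OF f x g insert.IH[OF g supp]] by metis
  qed
  then show ?thesis using assms(2) by (auto simp: free_module_def)
qed


section \<open>The tensor product\<close>

text \<open>
  As rewrite rules these bring a sum to a right-nested list of signed atoms in a fixed order, in which
  opposite atoms that happen to be adjacent cancel.
\<close>

lemmas (in abelian_group) abelian_group_simprules =
  a_closed zero_closed a_inv_closed minus_closed a_assoc l_zero l_neg a_comm minus_eq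
  r_zero r_neg r_neg2 r_neg1 minus_add minus_minus add.inv_one a_lcomm

locale tensor_factors = A: module K A + B: module K B
  for K :: "('k, 'm) ring_scheme" and A :: "('k, 'a, 'p) module_scheme"
    and B :: "('k, 'b, 'q) module_scheme"
begin

abbreviation "F \<equiv> free_module K (carrier A \<times> carrier B)"
abbreviation "N \<equiv> tensor_kernel K A B"
abbreviation "T \<equiv> tensor_product K A B"
abbreviation "t \<equiv> pure_tensor K A B"

lemma F_module: "module K F"
  by (rule free_module_module[OF A.R.is_cring])

sublocale F: module K F by (rule F_module)

lemma gen_closed: "\<lbrakk>a \<in> carrier A; b \<in> carrier B\<rbrakk> \<Longrightarrow> free_gen K (a, b) \<in> carrier F"
  by (rule free_gen_closed[OF A.R.is_cring]) simp

lemma tensor_relations_subset: "tensor_relations K A B \<subseteq> carrier F"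
  by (auto simp: tensor_relations_def Let_def gen_closed)

lemma tensor_kernel_submodule: "submodule N K F"
  unfolding tensor_kernel_def
  by (rule submodule_generated_submodule[OF F_module tensor_relations_subset])

lemma tensor_relations_kernel: "x \<in> tensor_relations K A B \<Longrightarrow> x \<in> N"
  unfolding tensor_kernel_def by (rule subsetD[OF submodule_generated_superset])

sublocale T: module K T
  unfolding tensor_product_def by (rule quotient_module_module[OF F_module tensor_kernel_submodule])

lemma coset_eq_iff:
  "\<lbrakk>x \<in> carrier F; y \<in> carrier F\<rbrakk> \<Longrightarrow> N +>\<^bsub>F\<^esub> x = N +>\<^bsub>F\<^esub> y \<longleftrightarrow> x \<ominus>\<^bsub>F\<^esub> y \<in> N"
  by (rule quotient_eq_iff[OF F_module tensor_kernel_submodule])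

lemma coset_module_linear: "module_linear K F T (\<lambda>x. N +>\<^bsub>F\<^esub> x)"
  unfolding tensor_product_def by (rule coset_linear[OF F_module tensor_kernel_submodule])

lemma pure_tensor_closed: "\<lbrakk>a \<in> carrier A; b \<in> carrier B\<rbrakk> \<Longrightarrow> t a b \<in> carrier T"
  using module_linearD(1)[OF coset_module_linear gen_closed] by (simp add: pure_tensor_def)

lemma pure_tensor_bilinear: "module_bilinear K A B T t"
proof -
  note lin = module_linearD(2,3)[OF coset_module_linear, symmetric]
  show ?thesis
    unfolding module_bilinear_def
  proof (intro conjI ballI)
    fix a a' b assume *: "a \<in> carrier A" "a' \<in> carrier A" "b \<in> carrier B"
    then have "free_gen K (a \<oplus>\<^bsub>A\<^esub> a', b) \<ominus>\<^bsub>F\<^esub> (free_gen K (a, b) \<oplus>\<^bsub>F\<^esub> free_gen K (a', b)) \<in> N"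
      by (intro tensor_relations_kernel, unfold tensor_relations_def Let_def) blast
    then show "t (a \<oplus>\<^bsub>A\<^esub> a') b = t a b \<oplus>\<^bsub>T\<^esub> t a' b"
      using * by (simp add: pure_tensor_def lin gen_closed coset_eq_iff)
  next
    fix a b b' assume *: "a \<in> carrier A" "b \<in> carrier B" "b' \<in> carrier B"
    then have "free_gen K (a, b \<oplus>\<^bsub>B\<^esub> b') \<ominus>\<^bsub>F\<^esub> (free_gen K (a, b) \<oplus>\<^bsub>F\<^esub> free_gen K (a, b')) \<in> N"
      by (intro tensor_relations_kernel, unfold tensor_relations_def Let_def) blast
    then show "t a (b \<oplus>\<^bsub>B\<^esub> b') = t a b \<oplus>\<^bsub>T\<^esub> t a b'"
      using * by (simp add: pure_tensor_def lin gen_closed coset_eq_iff)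
  next
    fix c a b assume *: "c \<in> carrier K" "a \<in> carrier A" "b \<in> carrier B"
    then have "free_gen K (c \<odot>\<^bsub>A\<^esub> a, b) \<ominus>\<^bsub>F\<^esub> c \<odot>\<^bsub>F\<^esub> free_gen K (a, b) \<in> N"
      by (intro tensor_relations_kernel, unfold tensor_relations_def Let_def) blast
    then show "t (c \<odot>\<^bsub>A\<^esub> a) b = c \<odot>\<^bsub>T\<^esub> t a b"
      using * by (simp add: pure_tensor_def lin gen_closed coset_eq_iff)
    have "free_gen K (a, c \<odot>\<^bsub>B\<^esub> b) \<ominus>\<^bsub>F\<^esub> c \<odot>\<^bsub>F\<^esub> free_gen K (a, b) \<in> N"
      using * by (intro tensor_relations_kernel, unfold tensor_relations_def Let_def) blast
    then show "t a (c \<odot>\<^bsub>B\<^esub> b) = c \<odot>\<^bsub>T\<^esub> t a b"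
      using * by (simp add: pure_tensor_def lin gen_closed coset_eq_iff)
  qed (rule pure_tensor_closed)
qed

text \<open>
  Linear combinations of pure tensors are already sums of pure tensors, because a scalar can be moved
  into the first factor; this is why closure under addition suffices.
\<close>

lemma tensor_induct [consumes 1, case_names pure add]:
  assumes "x \<in> carrier T"
    and pure: "\<And>a b. \<lbrakk>a \<in> carrier A; b \<in> carrier B\<rbrakk> \<Longrightarrow> P (t a b)"
    and add: "\<And>x y. \<lbrakk>x \<in> carrier T; y \<in> carrier T; P x; P y\<rbrakk> \<Longrightarrow> P (x \<oplus>\<^bsub>T\<^esub> y)"
  shows "P x"
proof -
  note lin = module_linearD[OF coset_module_linear]
  note t_lin = module_linearD(3)[OF module_bilinearD(1)[OF pure_tensor_bilinear]]
  have scaled: "c \<odot>\<^bsub>T\<^esub> t a b = t (c \<odot>\<^bsub>A\<^esub> a) b"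
    if "c \<in> carrier K" "a \<in> carrier A" "b \<in> carrier B" for a b c
    using that by (simp only: t_lin)
  have "P (N +>\<^bsub>F\<^esub> f)" if "f \<in> carrier F" for f
    using A.R.is_cring that
  proof (induction f rule: free_module_induct)
    case zero
    have "N +>\<^bsub>F\<^esub> \<zero>\<^bsub>F\<^esub> = \<zero>\<^bsub>T\<^esub>"
      by (rule module_linear_zero[OF F_module T.module_axioms coset_module_linear])
    also have "\<dots> = t \<zero>\<^bsub>A\<^esub> \<zero>\<^bsub>B\<^esub>"
      using module_linear_zero[OF A.module_axioms T.module_axioms module_bilinearD(1)[OF pure_tensor_bilinear]]
      by simp
    finally show ?case using pure by simp
  next
    case (gen c p f)
    obtain a b where p: "p = (a, b)" "a \<in> carrier A" "b \<in> carrier B" using gen by auto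
    have "N +>\<^bsub>F\<^esub> (c \<odot>\<^bsub>F\<^esub> free_gen K p \<oplus>\<^bsub>F\<^esub> f) = t (c \<odot>\<^bsub>A\<^esub> a) b \<oplus>\<^bsub>T\<^esub> (N +>\<^bsub>F\<^esub> f)"
      using gen p lin(2,3) gen_closed scaled[of c a b] by (simp add: pure_tensor_def)
    then show ?case
      using gen p pure add[OF pure_tensor_closed lin(1)] by simp
  qed
  moreover obtain f where "f \<in> carrier F" "x = N +>\<^bsub>F\<^esub> f"
    using assms(1) quotient_carrier[OF F_module tensor_kernel_submodule]
    by (auto simp: tensor_product_def)
  ultimately show ?thesis by simp
qed

text \<open>
  Universal property: the linear extension of \<open>f\<close> to the free module kills the defining relations
  because \<open>f\<close> is bilinear.  Its kernel is a submodule, so it contains the one they generate.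
\<close>

lemma tensor_lift:
  assumes W: "module K W" and f: "module_bilinear K A B W f"
  shows "\<exists>h. module_linear K T W h \<and> (\<forall>a\<in>carrier A. \<forall>b\<in>carrier B. h (t a b) = f a b)"
proof -
  interpret W: module K W by fact
  obtain h where h: "module_linear K F W h"
    and h_gen: "\<And>a b. \<lbrakk>a \<in> carrier A; b \<in> carrier B\<rbrakk> \<Longrightarrow> h (free_gen K (a, b)) = f a b"
    using free_module_lift[OF A.R.is_cring W, of "carrier A \<times> carrier B" "\<lambda>(a, b). f a b"]
      module_bilinearD(3)[OF f] by auto
  let ?Z = "{x \<in> carrier F. h x = \<zero>\<^bsub>W\<^esub>}"
  note lin = module_linearD[OF h] module_linear_diff[OF F_module W h] h_gen gen_closed
    module_linearD[OF module_bilinearD(1)[OF f]] module_linearD[OF module_bilinearD(2)[OF f]]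
  have cancel: "w \<ominus>\<^bsub>W\<^esub> w = \<zero>\<^bsub>W\<^esub>" if "w \<in> carrier W" for w
    using that by (simp add: a_minus_def W.M.r_neg)
  have "tensor_relations K A B \<subseteq> ?Z"
    by (auto simp: tensor_relations_def Let_def lin cancel)
  then have "N \<subseteq> ?Z"
    using linear_kernel_submodule[OF F_module W h]
    by (auto simp: tensor_kernel_def submodule_generated_def)
  then obtain g where "module_linear K T W g" "\<forall>x\<in>carrier F. g (N +>\<^bsub>F\<^esub> x) = h x"
    using quotient_lift[OF F_module tensor_kernel_submodule W h]
    by (auto simp: tensor_product_def)
  then show ?thesis
    using h_gen gen_closed by (auto simp: pure_tensor_def)
qed

lemma tensor_linear_eqI:
  assumes "module_linear K T W g" "module_linear K T W h" "x \<in> carrier T"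
    and "\<And>a b. \<lbrakk>a \<in> carrier A; b \<in> carrier B\<rbrakk> \<Longrightarrow> g (t a b) = h (t a b)"
  shows "g x = h x"
  using assms(3)
  by (induction rule: tensor_induct)
    (use assms in \<open>auto simp: module_linearD(2)[OF assms(1)] module_linearD(2)[OF assms(2)]\<close>)

lemma tensor_bilinear_eqI:
  assumes "module_bilinear K T T W g" "module_bilinear K T T W h" "x \<in> carrier T" "y \<in> carrier T"
    and "\<And>a b a' b'. \<lbrakk>a \<in> carrier A; b \<in> carrier B; a' \<in> carrier A; b' \<in> carrier B\<rbrakk> \<Longrightarrow>
      g (t a b) (t a' b') = h (t a b) (t a' b')"
  shows "g x y = h x y"
proof -
  have "g (t a b) y = h (t a b) y" if ab: "a \<in> carrier A" "b \<in> carrier B" for a b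
  proof -
    have "module_linear K T W (g (t a b))" "module_linear K T W (h (t a b))"
      using module_bilinearD(2)[OF assms(1) pure_tensor_closed[OF ab]]
        module_bilinearD(2)[OF assms(2) pure_tensor_closed[OF ab]] .
    then show ?thesis
      using assms(4) assms(5)[OF ab] by (rule tensor_linear_eqI[where W = W])
  qed
  then show ?thesis
    by (rule tensor_linear_eqI[where g = "\<lambda>x. g x y" and h = "\<lambda>x. h x y",
          OF module_bilinearD(1)[OF assms(1,4)] module_bilinearD(1)[OF assms(2,4)] assms(3)])
qed

text \<open>
  For fixed \<open>a\<close>, \<open>b\<close> the map \<open>f a b\<close> extends to a linear map \<open>L a b\<close> on the second copy of \<open>T\<close>.  For
  fixed \<open>y\<close>, the map \<open>L a b y\<close> is bilinear in \<open>a\<close>, \<open>b\<close>, and extends to a linear map \<open>G y\<close> on the first copy.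
  Both this bilinearity and the linearity of \<open>G\<close> in \<open>y\<close> need only be checked on sums of pure tensors.
\<close>

lemma tensor_bilinear_lift:
  assumes W: "module K W"
    and left: "\<And>a' b'. \<lbrakk>a' \<in> carrier A; b' \<in> carrier B\<rbrakk> \<Longrightarrow> module_bilinear K A B W (\<lambda>a b. f a b a' b')"
    and right: "\<And>a b. \<lbrakk>a \<in> carrier A; b \<in> carrier B\<rbrakk> \<Longrightarrow> module_bilinear K A B W (f a b)"
  shows "\<exists>g. module_bilinear K T T W g \<and>
    (\<forall>a\<in>carrier A. \<forall>a'\<in>carrier A. \<forall>b\<in>carrier B. \<forall>b'\<in>carrier B. g (t a b) (t a' b') = f a b a' b')"
proof -
  interpret W: module K W by fact
  have "\<exists>L. \<forall>a\<in>carrier A. \<forall>b\<in>carrier B. module_linear K T W (L a b) \<and>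
      (\<forall>a'\<in>carrier A. \<forall>b'\<in>carrier B. L a b (t a' b') = f a b a' b')"
    using tensor_lift[OF W right] by metis
  then obtain L where
    L: "\<And>a b. \<lbrakk>a \<in> carrier A; b \<in> carrier B\<rbrakk> \<Longrightarrow> module_linear K T W (L a b)" and
    L_pure: "\<And>a b a' b'. \<lbrakk>a \<in> carrier A; b \<in> carrier B; a' \<in> carrier A; b' \<in> carrier B\<rbrakk> \<Longrightarrow>
      L a b (t a' b') = f a b a' b'"
    by blast
  have "module_bilinear K A B W (\<lambda>a b. L a b y)" if "y \<in> carrier T" for y
    using that
  proof (induction rule: tensor_induct)
    case (pure a' b')
    then show ?case
      using left[OF pure] unfolding module_bilinear_def by (simp add: L_pure)
  next
    case (add x y)
    note lin = module_linearD[OF L] module_linearD[OF module_bilinearD(1)[OF add.IH(1)]]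
      module_linearD[OF module_bilinearD(2)[OF add.IH(1)]]
      module_linearD[OF module_bilinearD(1)[OF add.IH(2)]]
      module_linearD[OF module_bilinearD(2)[OF add.IH(2)]]
    show ?case
      using add.hyps unfolding module_bilinear_def
      by (simp add: lin W.smult_r_distr W.M.a_ac)
  qed
  then have "\<forall>y\<in>carrier T. \<exists>h. module_linear K T W h \<and>
      (\<forall>a\<in>carrier A. \<forall>b\<in>carrier B. h (t a b) = L a b y)"
    by (intro ballI tensor_lift[OF W])
  then have "\<exists>G. \<forall>y\<in>carrier T. module_linear K T W (G y) \<and>
      (\<forall>a\<in>carrier A. \<forall>b\<in>carrier B. G y (t a b) = L a b y)"
    by (rule bchoice)
  then obtain G where
    G: "\<And>y. y \<in> carrier T \<Longrightarrow> module_linear K T W (G y)" and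
    G_pure: "\<And>y a b. \<lbrakk>y \<in> carrier T; a \<in> carrier A; b \<in> carrier B\<rbrakk> \<Longrightarrow> G y (t a b) = L a b y"
    by blast
  have "module_linear K T W (\<lambda>y. G y x)" if "x \<in> carrier T" for x
    using that
  proof (induction rule: tensor_induct)
    case (pure a b)
    then show ?case
      using L[OF pure] unfolding module_linear_def by (simp add: G_pure)
  next
    case (add x x')
    note lin = module_linearD[OF G] module_linearD[OF add.IH(1)] module_linearD[OF add.IH(2)]
    show ?case
      using add.hyps by (intro module_linearI) (simp_all add: lin W.smult_r_distr W.M.a_ac)
  qed
  then have "module_bilinear K T T W (\<lambda>x y. G y x)"
    using G by (intro module_bilinearI) auto
  then show ?thesis
    using G_pure L_pure pure_tensor_closed by (intro exI[of _ "\<lambda>x y. G y x"]) simp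
qed

lemma tensor_operation_exists:
  assumes f: "module_bilinear K A A A f" and g: "module_bilinear K B B B g"
  shows "\<exists>h. module_bilinear K T T T h \<and>
    (\<forall>a\<in>carrier A. \<forall>a'\<in>carrier A. \<forall>b\<in>carrier B. \<forall>b'\<in>carrier B.
      h (t a b) (t a' b') = t (f a a') (g b b'))"
proof (rule tensor_bilinear_lift[OF T.module_axioms])
  note lin = module_linearD[OF module_bilinearD(1)[OF f]] module_linearD[OF module_bilinearD(2)[OF f]]
    module_linearD[OF module_bilinearD(1)[OF g]] module_linearD[OF module_bilinearD(2)[OF g]]
    module_linearD[OF module_bilinearD(1)[OF pure_tensor_bilinear]]
    module_linearD[OF module_bilinearD(2)[OF pure_tensor_bilinear]]
  show "module_bilinear K A B T (\<lambda>a b. t (f a a') (g b b'))"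
    if "a' \<in> carrier A" "b' \<in> carrier B" for a' b'
    using that unfolding module_bilinear_def by (simp add: lin)
  show "module_bilinear K A B T (\<lambda>a' b'. t (f a a') (g b b'))"
    if "a \<in> carrier A" "b \<in> carrier B" for a b
    using that unfolding module_bilinear_def by (simp add: lin)
qed

end


section \<open>Identities in Novikov and Jacobi Novikov-Poisson algebras\<close>

lemma (in novikov_algebra) nov_closed:
  "\<lbrakk>a \<in> carrier A; b \<in> carrier A\<rbrakk> \<Longrightarrow> nov a b \<in> carrier A"
  by (rule module_bilinearD(3)[OF nov_bilinear])

text \<open>
  A normal form for the twelve products of three elements.  The parameter \<open>pa\<close> stands for the two
  products \<open>(a b) c = (a c) b\<close>, and \<open>qc\<close> for the negated associator of \<open>a\<close>, \<open>b\<close>, \<open>c\<close>, which by left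
  symmetry does not change when \<open>a\<close> and \<open>b\<close> are exchanged; the others arise by permuting the letters.
\<close>

lemma (in novikov_algebra) triple_products:
  assumes a: "a \<in> carrier A" and b: "b \<in> carrier A" and c: "c \<in> carrier A"
  obtains pa pb pc qa qb qc
  where "pa \<in> carrier A" "pb \<in> carrier A" "pc \<in> carrier A"
    "qa \<in> carrier A" "qb \<in> carrier A" "qc \<in> carrier A"
    "nov (nov a b) c = pa" "nov (nov a c) b = pa"
    "nov (nov b a) c = pb" "nov (nov b c) a = pb"
    "nov (nov c a) b = pc" "nov (nov c b) a = pc"
    "nov a (nov b c) = pa \<oplus>\<^bsub>A\<^esub> qc" "nov b (nov a c) = pb \<oplus>\<^bsub>A\<^esub> qc"
    "nov b (nov c a) = pb \<oplus>\<^bsub>A\<^esub> qa" "nov c (nov b a) = pc \<oplus>\<^bsub>A\<^esub> qa"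
    "nov c (nov a b) = pc \<oplus>\<^bsub>A\<^esub> qb" "nov a (nov c b) = pa \<oplus>\<^bsub>A\<^esub> qb"
proof -
  have split: "\<exists>q\<in>carrier A. nov x (nov y z) = nov (nov x y) z \<oplus>\<^bsub>A\<^esub> q \<and>
      nov y (nov x z) = nov (nov y x) z \<oplus>\<^bsub>A\<^esub> q"
    if "x \<in> carrier A" "y \<in> carrier A" "z \<in> carrier A" for x y z
  proof -
    let ?q = "\<ominus>\<^bsub>A\<^esub> (nov (nov x y) z \<ominus>\<^bsub>A\<^esub> nov x (nov y z))"
    have recover: "u \<oplus>\<^bsub>A\<^esub> \<ominus>\<^bsub>A\<^esub> (u \<ominus>\<^bsub>A\<^esub> v) = v" if "u \<in> carrier A" "v \<in> carrier A" for u v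
      using that by (simp add: M.minus_eq M.minus_add M.r_neg2)
    have "nov (nov x y) z \<oplus>\<^bsub>A\<^esub> ?q = nov x (nov y z)"
      by (rule recover) (simp_all add: that nov_closed)
    moreover have "nov (nov y x) z \<oplus>\<^bsub>A\<^esub> ?q = nov y (nov x z)"
      unfolding left_symmetric[OF that] by (rule recover) (simp_all add: that nov_closed)
    ultimately show ?thesis
      by (intro bexI[of _ ?q]) (simp_all add: that nov_closed)
  qed
  \<comment> \<open>the three choices of the last factor\<close>
  obtain qc where "qc \<in> carrier A" "nov a (nov b c) = nov (nov a b) c \<oplus>\<^bsub>A\<^esub> qc"
    "nov b (nov a c) = nov (nov b a) c \<oplus>\<^bsub>A\<^esub> qc"
    using split[OF a b c] by auto
  moreover obtain qa where "qa \<in> carrier A" "nov b (nov c a) = nov (nov b c) a \<oplus>\<^bsub>A\<^esub> qa"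
    "nov c (nov b a) = nov (nov c b) a \<oplus>\<^bsub>A\<^esub> qa"
    using split[OF b c a] by auto
  moreover obtain qb where "qb \<in> carrier A" "nov c (nov a b) = nov (nov c a) b \<oplus>\<^bsub>A\<^esub> qb"
    "nov a (nov c b) = nov (nov a c) b \<oplus>\<^bsub>A\<^esub> qb"
    using split[OF c a b] by auto
  moreover note right_commutative[OF a b c] right_commutative[OF b a c] right_commutative[OF c a b]
  ultimately show thesis
    using a b c
    by (intro that[of "nov (nov a b) c" "nov (nov b a) c" "nov (nov c a) b" qa qb qc])
      (simp_all add: nov_closed)
qed

context jacobi_novikov_poisson_algebra
begin

text \<open>
  The operation is linear over multiplication in its left argument, and multiplication is commutative,
  so a factor may enter the left argument from either side.  The right-hand side is the common normal
  form used in the Leibniz rule.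
\<close>

lemma nov_factor_left:
  assumes "a \<in> carrier A" "b \<in> carrier A" "c \<in> carrier A"
  shows "nov b a \<otimes>\<^bsub>A\<^esub> c = nov (b \<otimes>\<^bsub>A\<^esub> c) a"
    and "b \<otimes>\<^bsub>A\<^esub> nov c a = nov (b \<otimes>\<^bsub>A\<^esub> c) a"
    and "(b \<otimes>\<^bsub>A\<^esub> c) \<otimes>\<^bsub>A\<^esub> nov \<one>\<^bsub>A\<^esub> a = nov (b \<otimes>\<^bsub>A\<^esub> c) a"
proof -
  have "nov b a \<otimes>\<^bsub>A\<^esub> c = c \<otimes>\<^bsub>A\<^esub> nov b a"
    using assms by (simp add: nov_closed m_comm)
  also have "\<dots> = nov (c \<otimes>\<^bsub>A\<^esub> b) a"
    using assms by (simp add: mult_nov)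
  also have "\<dots> = nov (b \<otimes>\<^bsub>A\<^esub> c) a"
    using assms by (simp add: m_comm)
  finally show "nov b a \<otimes>\<^bsub>A\<^esub> c = nov (b \<otimes>\<^bsub>A\<^esub> c) a" .
  show "b \<otimes>\<^bsub>A\<^esub> nov c a = nov (b \<otimes>\<^bsub>A\<^esub> c) a"
    using assms by (simp add: mult_nov)
  show "(b \<otimes>\<^bsub>A\<^esub> c) \<otimes>\<^bsub>A\<^esub> nov \<one>\<^bsub>A\<^esub> a = nov (b \<otimes>\<^bsub>A\<^esub> c) a"
    using assms mult_nov[of "b \<otimes>\<^bsub>A\<^esub> c" "\<one>\<^bsub>A\<^esub>" a] by simp
qed

end


section \<open>The operations on the tensor product\<close>

lemma is_tensor_multD:
  assumes "is_tensor_mult K A B mul"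
  shows "module_bilinear K (tensor_product K A B) (tensor_product K A B) (tensor_product K A B) mul"
    and "\<lbrakk>a1 \<in> carrier A; b1 \<in> carrier A; a2 \<in> carrier B; b2 \<in> carrier B\<rbrakk> \<Longrightarrow>
      mul (pure_tensor K A B a1 a2) (pure_tensor K A B b1 b2) =
        pure_tensor K A B (a1 \<otimes>\<^bsub>A\<^esub> b1) (a2 \<otimes>\<^bsub>B\<^esub> b2)"
  using assms by (simp_all add: is_tensor_mult_def Let_def)

lemma is_tensor_bracketD:
  assumes "is_tensor_bracket K A B circ dia br"
  shows "module_bilinear K (tensor_product K A B) (tensor_product K A B) (tensor_product K A B) br"
    and "\<lbrakk>a1 \<in> carrier A; b1 \<in> carrier A; a2 \<in> carrier B; b2 \<in> carrier B\<rbrakk> \<Longrightarrow>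
      br (pure_tensor K A B a1 a2) (pure_tensor K A B b1 b2) =
        pure_tensor K A B (circ a1 b1) (dia a2 b2) \<ominus>\<^bsub>tensor_product K A B\<^esub>
        pure_tensor K A B (circ b1 a1) (dia b2 a2)"
  using assms by (simp_all add: is_tensor_bracket_def Let_def)

lemma (in algebra) mult_bilinear: "module_bilinear R M M M (\<otimes>\<^bsub>M\<^esub>)"
  unfolding module_bilinear_def
proof (intro conjI ballI)
  fix c x y assume "c \<in> carrier R" "x \<in> carrier M" "y \<in> carrier M"
  then show "x \<otimes>\<^bsub>M\<^esub> (c \<odot>\<^bsub>M\<^esub> y) = c \<odot>\<^bsub>M\<^esub> (x \<otimes>\<^bsub>M\<^esub> y)"
    using smult_assoc2[of c y x] m_comm[of x "c \<odot>\<^bsub>M\<^esub> y"] m_comm[of x y] by simp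
qed (simp_all add: l_distr r_distr smult_assoc2)

context tensor_factors
begin

text \<open>
  An operation is only determined on the carrier of \<open>T\<close>, so uniqueness is stated for extensional
  functions, and a given bilinear operation has to be restricted first.
\<close>

lemma bilinear_operation_ex1:
  assumes "\<exists>h. module_bilinear K T T T h \<and>
    (\<forall>a\<in>carrier A. \<forall>a'\<in>carrier A. \<forall>b\<in>carrier B. \<forall>b'\<in>carrier B. h (t a b) (t a' b') = w a a' b b')"
  shows "\<exists>!h. h \<in> carrier T \<rightarrow>\<^sub>E (carrier T \<rightarrow>\<^sub>E carrier T) \<and> module_bilinear K T T T h \<and>
    (\<forall>a\<in>carrier A. \<forall>a'\<in>carrier A. \<forall>b\<in>carrier B. \<forall>b'\<in>carrier B. h (t a b) (t a' b') = w a a' b b')"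
proof (rule ex_ex1I)
  obtain h where h: "module_bilinear K T T T h"
    and h_pure: "\<And>a a' b b'. \<lbrakk>a \<in> carrier A; a' \<in> carrier A; b \<in> carrier B; b' \<in> carrier B\<rbrakk> \<Longrightarrow>
      h (t a b) (t a' b') = w a a' b b'"
    using assms by blast
  let ?h = "\<lambda>x\<in>carrier T. \<lambda>y\<in>carrier T. h x y"
  have "module_bilinear K T T T ?h"
    using h by (simp add: module_bilinear_def)
  moreover have "?h \<in> carrier T \<rightarrow>\<^sub>E (carrier T \<rightarrow>\<^sub>E carrier T)"
    using module_bilinearD(3)[OF h] by auto
  ultimately show "\<exists>h. h \<in> carrier T \<rightarrow>\<^sub>E (carrier T \<rightarrow>\<^sub>E carrier T) \<and> module_bilinear K T T T h \<and>
    (\<forall>a\<in>carrier A. \<forall>a'\<in>carrier A. \<forall>b\<in>carrier B. \<forall>b'\<in>carrier B. h (t a b) (t a' b') = w a a' b b')"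
    using h_pure pure_tensor_closed by (intro exI[of _ ?h]) simp
next
  fix g h
  assume g: "g \<in> carrier T \<rightarrow>\<^sub>E (carrier T \<rightarrow>\<^sub>E carrier T) \<and> module_bilinear K T T T g \<and>
    (\<forall>a\<in>carrier A. \<forall>a'\<in>carrier A. \<forall>b\<in>carrier B. \<forall>b'\<in>carrier B. g (t a b) (t a' b') = w a a' b b')"
    and h: "h \<in> carrier T \<rightarrow>\<^sub>E (carrier T \<rightarrow>\<^sub>E carrier T) \<and> module_bilinear K T T T h \<and>
    (\<forall>a\<in>carrier A. \<forall>a'\<in>carrier A. \<forall>b\<in>carrier B. \<forall>b'\<in>carrier B. h (t a b) (t a' b') = w a a' b b')"
  have "g x y = h x y" if "x \<in> carrier T" "y \<in> carrier T" for x y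
    by (rule tensor_bilinear_eqI[where g = g and h = h and W = T]) (use g h that in simp_all)
  moreover have "g x \<in> carrier T \<rightarrow>\<^sub>E carrier T" "h x \<in> carrier T \<rightarrow>\<^sub>E carrier T" if "x \<in> carrier T" for x
    using PiE_mem[OF conjunct1[OF g] that] PiE_mem[OF conjunct1[OF h] that] .
  ultimately have "g x = h x" if "x \<in> carrier T" for x
    using that by (intro PiE_ext[of "g x" "carrier T" "\<lambda>_. carrier T"]) simp_all
  then show "g = h"
    by (intro PiE_ext[OF conjunct1[OF g] conjunct1[OF h]])
qed

lemma tensor_mult_ex1:
  assumes "algebra K A" "algebra K B"
  shows "\<exists>!mul. mul \<in> carrier T \<rightarrow>\<^sub>E (carrier T \<rightarrow>\<^sub>E carrier T) \<and> is_tensor_mult K A B mul"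
  unfolding is_tensor_mult_def Let_def
  by (intro bilinear_operation_ex1 tensor_operation_exists algebra.mult_bilinear assms)

text \<open>
  The bracket is the commutator \<open>h x y - h y x\<close> of the bilinear operation \<open>h\<close> that is \<open>circ\<close> on the first
  factor and \<open>dia\<close> on the second.
\<close>

lemma tensor_bracket_ex1:
  assumes f: "module_bilinear K A A A circ" and g: "module_bilinear K B B B dia"
  shows "\<exists>!br. br \<in> carrier T \<rightarrow>\<^sub>E (carrier T \<rightarrow>\<^sub>E carrier T) \<and> is_tensor_bracket K A B circ dia br"
proof -
  obtain h where h: "module_bilinear K T T T h"
    and h_pure: "\<And>a a' b b'. \<lbrakk>a \<in> carrier A; a' \<in> carrier A; b \<in> carrier B; b' \<in> carrier B\<rbrakk> \<Longrightarrow>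
      h (t a b) (t a' b') = t (circ a a') (dia b b')"
    using tensor_operation_exists[OF f g] by blast
  note lin = module_linearD[OF module_bilinearD(1)[OF h]] module_linearD[OF module_bilinearD(2)[OF h]]
  have "module_bilinear K T T T (\<lambda>x y. h x y \<ominus>\<^bsub>T\<^esub> h y x)"
    unfolding module_bilinear_def a_minus_def
    by (simp add: lin T.smult_r_distr T.smult_r_minus T.M.minus_add T.M.a_ac)
  then show ?thesis
    unfolding is_tensor_bracket_def Let_def
    using h_pure pure_tensor_closed
    by (intro bilinear_operation_ex1 exI[of _ "\<lambda>x y. h x y \<ominus>\<^bsub>T\<^esub> h y x"]) simp
qed

text \<open>
  Identities in three variables that are additive in each of them are proved with this rule.
\<close>

lemma tensor_induct3:
  assumes "x \<in> carrier T" "y \<in> carrier T" "z \<in> carrier T"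
    and pure: "\<And>a1 a2 b1 b2 c1 c2. \<lbrakk>a1 \<in> carrier A; a2 \<in> carrier B; b1 \<in> carrier A; b2 \<in> carrier B;
      c1 \<in> carrier A; c2 \<in> carrier B\<rbrakk> \<Longrightarrow> P (t a1 a2) (t b1 b2) (t c1 c2)"
    and add1: "\<And>x x' y z. \<lbrakk>x \<in> carrier T; x' \<in> carrier T; y \<in> carrier T; z \<in> carrier T;
      P x y z; P x' y z\<rbrakk> \<Longrightarrow> P (x \<oplus>\<^bsub>T\<^esub> x') y z"
    and add2: "\<And>x y y' z. \<lbrakk>x \<in> carrier T; y \<in> carrier T; y' \<in> carrier T; z \<in> carrier T;
      P x y z; P x y' z\<rbrakk> \<Longrightarrow> P x (y \<oplus>\<^bsub>T\<^esub> y') z"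
    and add3: "\<And>x y z z'. \<lbrakk>x \<in> carrier T; y \<in> carrier T; z \<in> carrier T; z' \<in> carrier T;
      P x y z; P x y z'\<rbrakk> \<Longrightarrow> P x y (z \<oplus>\<^bsub>T\<^esub> z')"
  shows "P x y z"
proof -
  have 1: "P (t a1 a2) (t b1 b2) z"
    if "a1 \<in> carrier A" "a2 \<in> carrier B" "b1 \<in> carrier A" "b2 \<in> carrier B" for a1 a2 b1 b2
    using assms(3) by (induction rule: tensor_induct) (simp_all add: that pure add3 pure_tensor_closed)
  have 2: "P (t a1 a2) y z" if "a1 \<in> carrier A" "a2 \<in> carrier B" for a1 a2
    using assms(2)
    by (induction rule: tensor_induct) (simp_all add: that 1 add2 assms(3) pure_tensor_closed)
  show ?thesis
    using assms(1) by (induction rule: tensor_induct) (simp_all add: 2 add1 assms(2,3))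
qed

end


section \<open>The commutative algebra\<close>

text \<open>
  The Jacobi algebra arises from the tensor product by filling in these two record fields.
\<close>

lemma module_update_mult_one:
  assumes "module K M"
  shows "module K (M\<lparr>monoid.mult := f, one := e\<rparr>)"
proof -
  interpret M: module K M by fact
  show ?thesis
  proof (rule moduleI)
    show "abelian_group (M\<lparr>monoid.mult := f, one := e\<rparr>)"
    proof (rule abelian_groupI)
      fix x assume "x \<in> carrier (M\<lparr>monoid.mult := f, one := e\<rparr>)"
      then show "\<exists>y\<in>carrier (M\<lparr>monoid.mult := f, one := e\<rparr>).
          y \<oplus>\<^bsub>M\<lparr>monoid.mult := f, one := e\<rparr>\<^esub> x = \<zero>\<^bsub>M\<lparr>monoid.mult := f, one := e\<rparr>\<^esub>"
        by (intro bexI[of _ "\<ominus>\<^bsub>M\<^esub> x"]) (simp_all add: M.M.l_neg)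
    qed (simp_all add: M.M.a_ac)
  qed (simp_all add: M.R.is_cring M.smult_l_distr M.smult_r_distr M.smult_assoc1)
qed

lemma module_bilinear_update_mult_one:
  "module_bilinear K (M\<lparr>monoid.mult := f, one := e\<rparr>) (M\<lparr>monoid.mult := f, one := e\<rparr>)
     (M\<lparr>monoid.mult := f, one := e\<rparr>) g \<longleftrightarrow> module_bilinear K M M M g"
  by (simp add: module_bilinear_def)

context tensor_factors
begin

lemma tensor_algebra:
  assumes "algebra K A" "algebra K B" and mul: "is_tensor_mult K A B mul"
  shows "algebra K (T\<lparr>monoid.mult := mul, one := t \<one>\<^bsub>A\<^esub> \<one>\<^bsub>B\<^esub>\<rparr>)"
proof -
  interpret algA: algebra K A by fact
  interpret algB: algebra K B by fact
  let ?J = "T\<lparr>monoid.mult := mul, one := t \<one>\<^bsub>A\<^esub> \<one>\<^bsub>B\<^esub>\<rparr>"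
  note bil = is_tensor_multD(1)[OF mul] and pure = is_tensor_multD(2)[OF mul]
  note lin = module_linearD[OF module_bilinearD(1)[OF bil]] module_linearD[OF module_bilinearD(2)[OF bil]]
  have assoc: "mul (mul x y) z = mul x (mul y z)"
    if "x \<in> carrier T" "y \<in> carrier T" "z \<in> carrier T" for x y z
    using that by (rule tensor_induct3) (simp_all add: pure lin algA.m_assoc algB.m_assoc)
  have flip: "module_bilinear K T T T (\<lambda>x y. mul y x)"
    using bil by (simp add: module_bilinear_def)
  have comm: "mul x y = mul y x" if "x \<in> carrier T" "y \<in> carrier T" for x y
    by (rule tensor_bilinear_eqI[where h = "\<lambda>x y. mul y x", OF bil flip that])
      (simp add: pure algA.m_comm algB.m_comm)
  have one: "t \<one>\<^bsub>A\<^esub> \<one>\<^bsub>B\<^esub> \<in> carrier T" by (simp add: pure_tensor_closed)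
  have l_one: "mul (t \<one>\<^bsub>A\<^esub> \<one>\<^bsub>B\<^esub>) x = x" if "x \<in> carrier T" for x
    using that by (induction rule: tensor_induct) (simp_all add: pure lin one)
  have J: "module K ?J"
    by (rule module_update_mult_one[OF T.module_axioms])
  interpret J: module K ?J by (rule J)
  have "comm_monoid ?J"
    by (rule comm_monoidI) (simp_all add: assoc l_one one lin, rule comm)
  then have "cring ?J"
    by (intro cringI J.M.abelian_group_axioms) (simp_all add: lin)
  then show ?thesis
    by (intro algebra.intro J algebra_axioms.intro) (simp_all add: lin)
qed


section \<open>The Lie algebra\<close>

text \<open>
  On pure tensors, \<open>triple_products\<close> in \<open>A\<close> and in \<open>B\<close> with the opposite operation expresses all the
  iterated products by six elements of each factor, after which every term occurs once with each sign.
\<close>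

lemma tensor_jacobi_identity:
  assumes "novikov_algebra K A circ" "novikov_algebra K B (\<lambda>x y. dia y x)"
    and br: "is_tensor_bracket K A B circ dia br"
    and "x \<in> carrier T" "y \<in> carrier T" "z \<in> carrier T"
  shows "br x (br y z) \<oplus>\<^bsub>T\<^esub> br y (br z x) \<oplus>\<^bsub>T\<^esub> br z (br x y) = \<zero>\<^bsub>T\<^esub>"
proof -
  interpret nA: novikov_algebra K A circ by fact
  interpret nB: novikov_algebra K B "\<lambda>x y. dia y x" by fact
  note bil = is_tensor_bracketD(1)[OF br] and pure = is_tensor_bracketD(2)[OF br]
  note lin = module_linearD[OF module_bilinearD(1)[OF bil]] module_linearD[OF module_bilinearD(2)[OF bil]]
  note br_diff = module_linear_diff[OF T.module_axioms T.module_axioms module_bilinearD(2)[OF bil]]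
  note t_add = module_linearD(2)[OF module_bilinearD(1)[OF pure_tensor_bilinear]]
    module_linearD(2)[OF module_bilinearD(2)[OF pure_tensor_bilinear]]
  have regroup: "(u \<oplus>\<^bsub>T\<^esub> u') \<oplus>\<^bsub>T\<^esub> (v \<oplus>\<^bsub>T\<^esub> v') \<oplus>\<^bsub>T\<^esub> (w \<oplus>\<^bsub>T\<^esub> w') = \<zero>\<^bsub>T\<^esub>"
    if "u \<oplus>\<^bsub>T\<^esub> v \<oplus>\<^bsub>T\<^esub> w = \<zero>\<^bsub>T\<^esub>" "u' \<oplus>\<^bsub>T\<^esub> v' \<oplus>\<^bsub>T\<^esub> w' = \<zero>\<^bsub>T\<^esub>"
      "u \<in> carrier T" "v \<in> carrier T" "w \<in> carrier T"
      "u' \<in> carrier T" "v' \<in> carrier T" "w' \<in> carrier T" for u u' v v' w w'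
  proof -
    have "(u \<oplus>\<^bsub>T\<^esub> u') \<oplus>\<^bsub>T\<^esub> (v \<oplus>\<^bsub>T\<^esub> v') \<oplus>\<^bsub>T\<^esub> (w \<oplus>\<^bsub>T\<^esub> w') =
        (u \<oplus>\<^bsub>T\<^esub> v \<oplus>\<^bsub>T\<^esub> w) \<oplus>\<^bsub>T\<^esub> (u' \<oplus>\<^bsub>T\<^esub> v' \<oplus>\<^bsub>T\<^esub> w')"
      using that(3-) by (simp add: T.M.a_ac)
    then show ?thesis using that(1,2) by simp
  qed
  show ?thesis
    using assms(4-6)
  proof (rule tensor_induct3)
    fix a1 a2 b1 b2 c1 c2
    assume carr: "a1 \<in> carrier A" "a2 \<in> carrier B" "b1 \<in> carrier A" "b2 \<in> carrier B"
      "c1 \<in> carrier A" "c2 \<in> carrier B"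
    obtain pa pb pc qa qb qc where p: "pa \<in> carrier A" "pb \<in> carrier A" "pc \<in> carrier A"
      "qa \<in> carrier A" "qb \<in> carrier A" "qc \<in> carrier A"
      and circ: "circ (circ a1 b1) c1 = pa" "circ (circ a1 c1) b1 = pa"
        "circ (circ b1 a1) c1 = pb" "circ (circ b1 c1) a1 = pb"
        "circ (circ c1 a1) b1 = pc" "circ (circ c1 b1) a1 = pc"
        "circ a1 (circ b1 c1) = pa \<oplus>\<^bsub>A\<^esub> qc" "circ b1 (circ a1 c1) = pb \<oplus>\<^bsub>A\<^esub> qc"
        "circ b1 (circ c1 a1) = pb \<oplus>\<^bsub>A\<^esub> qa" "circ c1 (circ b1 a1) = pc \<oplus>\<^bsub>A\<^esub> qa"
        "circ c1 (circ a1 b1) = pc \<oplus>\<^bsub>A\<^esub> qb" "circ a1 (circ c1 b1) = pa \<oplus>\<^bsub>A\<^esub> qb"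
      using nA.triple_products[OF carr(1,3,5)] by blast
    obtain Pa Pb Pc Qa Qb Qc where P: "Pa \<in> carrier B" "Pb \<in> carrier B" "Pc \<in> carrier B"
      "Qa \<in> carrier B" "Qb \<in> carrier B" "Qc \<in> carrier B"
      and dia: "dia c2 (dia b2 a2) = Pa" "dia b2 (dia c2 a2) = Pa"
        "dia c2 (dia a2 b2) = Pb" "dia a2 (dia c2 b2) = Pb"
        "dia b2 (dia a2 c2) = Pc" "dia a2 (dia b2 c2) = Pc"
        "dia (dia c2 b2) a2 = Pa \<oplus>\<^bsub>B\<^esub> Qc" "dia (dia c2 a2) b2 = Pb \<oplus>\<^bsub>B\<^esub> Qc"
        "dia (dia a2 c2) b2 = Pb \<oplus>\<^bsub>B\<^esub> Qa" "dia (dia a2 b2) c2 = Pc \<oplus>\<^bsub>B\<^esub> Qa"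
        "dia (dia b2 a2) c2 = Pc \<oplus>\<^bsub>B\<^esub> Qb" "dia (dia b2 c2) a2 = Pa \<oplus>\<^bsub>B\<^esub> Qb"
      using nB.triple_products[OF carr(2,4,6)] by blast
    show "br (t a1 a2) (br (t b1 b2) (t c1 c2)) \<oplus>\<^bsub>T\<^esub> br (t b1 b2) (br (t c1 c2) (t a1 a2)) \<oplus>\<^bsub>T\<^esub>
        br (t c1 c2) (br (t a1 a2) (t b1 b2)) = \<zero>\<^bsub>T\<^esub>"
      \<comment> \<open>The second step sorts the terms with the positive ones first; the third collects the
        negative ones into the negative of one sum, which is the sum of the positive ones.\<close>
      by (simp add: pure br_diff pure_tensor_closed carr nA.nov_closed nB.nov_closed circ dia t_add p P)
        (simp add: pure_tensor_closed p P T.M.abelian_group_simprules,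
         simp add: pure_tensor_closed p P T.M.a_assoc[symmetric] T.M.minus_add[symmetric] T.M.r_neg)
  qed (simp_all add: lin regroup)
qed

text \<open>
  Skew symmetry is bilinear and hence holds everywhere once it holds on pure tensors.  The alternating
  law is quadratic; the mixed terms in its induction step cancel by skew symmetry.
\<close>

lemma tensor_lie_algebra:
  assumes "novikov_algebra K A circ" "novikov_algebra K B (\<lambda>x y. dia y x)"
    and br: "is_tensor_bracket K A B circ dia br"
  shows "lie_algebra K T br"
proof -
  interpret nA: novikov_algebra K A circ by fact
  interpret nB: novikov_algebra K B "\<lambda>x y. dia y x" by fact
  note bil = is_tensor_bracketD(1)[OF br] and pure = is_tensor_bracketD(2)[OF br]
  note lin = module_linearD[OF module_bilinearD(1)[OF bil]] module_linearD[OF module_bilinearD(2)[OF bil]]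
  have flip: "module_bilinear K T T T (\<lambda>x y. \<ominus>\<^bsub>T\<^esub> br y x)"
    unfolding module_bilinear_def by (simp add: lin T.smult_r_minus T.M.minus_add T.M.a_ac)
  have skew: "br x y = \<ominus>\<^bsub>T\<^esub> br y x" if "x \<in> carrier T" "y \<in> carrier T" for x y
    by (rule tensor_bilinear_eqI[where h = "\<lambda>x y. \<ominus>\<^bsub>T\<^esub> br y x", OF bil flip that])
      (simp add: pure nA.nov_closed nB.nov_closed pure_tensor_closed T.M.minus_eq T.M.minus_add T.M.a_comm)
  have alternating: "br x x = \<zero>\<^bsub>T\<^esub>" if "x \<in> carrier T" for x
    using that
  proof (induction rule: tensor_induct)
    case (pure a b)
    then show ?case
      by (simp add: is_tensor_bracketD(2)[OF br] nA.nov_closed nB.nov_closed pure_tensor_closed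
          T.M.minus_eq T.M.r_neg)
  next
    case (add x y)
    then show ?case
      by (simp add: lin skew[of y x] T.M.r_neg T.M.l_neg)
  qed
  show ?thesis
    by (intro lie_algebra.intro nA.field_axioms T.module_axioms lie_algebra_axioms.intro bil
        alternating tensor_jacobi_identity[OF assms])
qed


section \<open>The Leibniz rule\<close>

text \<open>
  On pure tensors the rules of both factors bring the two sides to the same six terms
  \<open>X\<^sub>i \<otimes> U\<close> and \<open>Y \<otimes> V\<^sub>i\<close>.
\<close>

lemma tensor_leibniz_rule:
  assumes "jacobi_novikov_poisson_algebra K A circ"
    and "right_jacobi_novikov_poisson_algebra K B dia"
    and mul: "is_tensor_mult K A B mul" and br: "is_tensor_bracket K A B circ dia br"
    and "x \<in> carrier T" "y \<in> carrier T" "z \<in> carrier T"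
  shows "br x (mul y z) = (mul (br x y) z \<oplus>\<^bsub>T\<^esub> mul y (br x z)) \<oplus>\<^bsub>T\<^esub>
    mul (mul y z) (br (t \<one>\<^bsub>A\<^esub> \<one>\<^bsub>B\<^esub>) x)"
proof -
  interpret jA: jacobi_novikov_poisson_algebra K A circ by fact
  interpret jB: jacobi_novikov_poisson_algebra K B "\<lambda>x y. dia y x"
    using assms(2) by (simp add: right_jacobi_novikov_poisson_algebra_def)
  note bil = is_tensor_bracketD(1)[OF br] is_tensor_multD(1)[OF mul]
  note pure = is_tensor_bracketD(2)[OF br] is_tensor_multD(2)[OF mul]
  note lin = module_linearD[OF module_bilinearD(1)[OF bil(1)]] module_linearD[OF module_bilinearD(2)[OF bil(1)]]
    module_linearD[OF module_bilinearD(1)[OF bil(2)]] module_linearD[OF module_bilinearD(2)[OF bil(2)]]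
  note mul_diff =
    module_linear_diff[OF T.module_axioms T.module_axioms module_bilinearD(1)[OF bil(2)]]
    module_linear_diff[OF T.module_axioms T.module_axioms module_bilinearD(2)[OF bil(2)]]
  note t_lin = module_linearD(2)[OF module_bilinearD(1)[OF pure_tensor_bilinear]]
    module_linearD(2)[OF module_bilinearD(2)[OF pure_tensor_bilinear]]
    module_linear_diff[OF A.module_axioms T.module_axioms module_bilinearD(1)[OF pure_tensor_bilinear]]
    module_linear_diff[OF B.module_axioms T.module_axioms module_bilinearD(2)[OF pure_tensor_bilinear]]
  have one: "t \<one>\<^bsub>A\<^esub> \<one>\<^bsub>B\<^esub> \<in> carrier T" by (simp add: pure_tensor_closed)
  show ?thesis
    using assms(5-7)
  proof (rule tensor_induct3)
    fix a1 a2 b1 b2 c1 c2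
    assume carr: "a1 \<in> carrier A" "a2 \<in> carrier B" "b1 \<in> carrier A" "b2 \<in> carrier B"
      "c1 \<in> carrier A" "c2 \<in> carrier B"
    note A_rules = jA.nov_mult[OF carr(3,5,1)] jA.nov_factor_left[OF carr(1,3,5)]
    note B_rules = jB.nov_mult[OF carr(4,6,2)] jB.nov_factor_left[OF carr(2,4,6)]
    show "br (t a1 a2) (mul (t b1 b2) (t c1 c2)) =
        (mul (br (t a1 a2) (t b1 b2)) (t c1 c2) \<oplus>\<^bsub>T\<^esub> mul (t b1 b2) (br (t a1 a2) (t c1 c2))) \<oplus>\<^bsub>T\<^esub>
        mul (mul (t b1 b2) (t c1 c2)) (br (t \<one>\<^bsub>A\<^esub> \<one>\<^bsub>B\<^esub>) (t a1 a2))"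
      by (simp add: pure mul_diff pure_tensor_closed carr jA.nov_closed jB.nov_closed A_rules B_rules
          t_lin)
        (simp add: pure_tensor_closed carr jA.nov_closed jB.nov_closed T.M.abelian_group_simprules)
  qed (simp_all add: lin one T.M.a_ac)
qed

end

section \<open>The Jacobi algebra\<close>

theorem theorem2p9:
  fixes K :: "('k, 'm) ring_scheme"
    and A :: "('k, 'a, 'p) module_scheme" and circ :: "'a \<Rightarrow> 'a \<Rightarrow> 'a"
    and B :: "('k, 'b, 'q) module_scheme" and dia :: "'b \<Rightarrow> 'b \<Rightarrow> 'b"
  assumes "field K"
    and "jacobi_novikov_poisson_algebra K A circ"
    and "right_jacobi_novikov_poisson_algebra K B dia"
  shows
    "(\<exists>!mul. mul \<in> carrier (tensor_product K A B) \<rightarrow>\<^sub>E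
                (carrier (tensor_product K A B) \<rightarrow>\<^sub>E carrier (tensor_product K A B)) \<and>
             is_tensor_mult K A B mul) \<and>
     (\<exists>!br. br \<in> carrier (tensor_product K A B) \<rightarrow>\<^sub>E
                (carrier (tensor_product K A B) \<rightarrow>\<^sub>E carrier (tensor_product K A B)) \<and>
             is_tensor_bracket K A B circ dia br) \<and>
     (\<forall>mul br. is_tensor_mult K A B mul \<longrightarrow> is_tensor_bracket K A B circ dia br \<longrightarrow>
        jacobi_algebra K
          ((tensor_product K A B)
             \<lparr>monoid.mult := mul, one := pure_tensor K A B \<one>\<^bsub>A\<^esub> \<one>\<^bsub>B\<^esub>\<rparr>) br)"
proof -
  interpret jA: jacobi_novikov_poisson_algebra K A circ by fact
  interpret jB: jacobi_novikov_poisson_algebra K B "\<lambda>x y. dia y x"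
    using assms(3) by (simp add: right_jacobi_novikov_poisson_algebra_def)
  interpret tensor_factors K A B
    by (intro tensor_factors.intro jA.module_axioms jB.module_axioms)
  have dia: "module_bilinear K B B B dia"
    using jB.nov_bilinear by (simp add: module_bilinear_def)
  have "jacobi_algebra K (T\<lparr>monoid.mult := mul, one := t \<one>\<^bsub>A\<^esub> \<one>\<^bsub>B\<^esub>\<rparr>) br" (is "jacobi_algebra K ?J br")
    if mul: "is_tensor_mult K A B mul" and br: "is_tensor_bracket K A B circ dia br" for mul br
  proof -
    interpret lie_T: lie_algebra K T br
      by (rule tensor_lie_algebra[OF jA.novikov_algebra_axioms jB.novikov_algebra_axioms br])
    have alg: "algebra K ?J"
      by (rule tensor_algebra[OF jA.algebra_axioms jB.algebra_axioms mul])
    moreover have "lie_algebra K ?J br"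
      using lie_T.br_alternating lie_T.br_jacobi
      by (intro lie_algebra.intro lie_algebra_axioms.intro jA.field_axioms algebra.axioms(1)[OF alg])
        (simp_all add: module_bilinear_update_mult_one lie_T.br_bilinear)
    moreover have "jacobi_algebra_axioms ?J br"
      using tensor_leibniz_rule[OF assms(2,3) mul br]
      by (intro jacobi_algebra_axioms.intro) simp
    ultimately show ?thesis
      by (rule jacobi_algebra.intro)
  qed
  then show ?thesis
    using tensor_mult_ex1[OF jA.algebra_axioms jB.algebra_axioms]
      tensor_bracket_ex1[OF jA.nov_bilinear dia] by blast
qed

end
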